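(* Let $f,h_1\in\mathbb{Z}[X]$, let $\varepsilon\in\{1,-1\}$, and let ${\bf a}=(a_n)_{n\in\mathbb{N}}$ be given by $a_0=h_1(0)$, $a_n=f(n)a_{n-1}+\varepsilon^n h_1(n)$ for $n>0$. Assume that the sequence ${\bf a}$ is unbounded and that for each prime number $p$ there are integers $n,m$ such that $p\mid f(n)$ and $p\nmid h_1(m)$. Then the set $\mathcal{P}_{\bf a}$ is infinite.
   Context: $\mathbb{N}=\{0,1,2,\dots\}$. For a sequence of integers ${\bf a}=(a_n)_{n\in\mathbb{N}}$, $\mathcal{P}_{\bf a}$ is the set of all prime numbers $p$ such that $p\mid a_n$ for some $n\in\mathbb{N}$. *)

theory Defs
  imports "HOL-Analysis.Analysis" "HOL-Computational_Algebra.Computational_Algebra"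
begin

definition seq_primes :: "(nat \<Rightarrow> int) \<Rightarrow> nat set" where
  "seq_primes a = {p. prime p \<and> (\<exists>n. int p dvd a n)}"

end

theory Submission
  imports Defs "HOL-Number_Theory.Cong"
begin

text \<open>
  Replacing \<open>a n\<close> by \<open>\<epsilon> ^ n * a n\<close> and \<open>f\<close> by \<open>\<epsilon> f\<close>, we may take \<open>\<epsilon> = 1\<close>. Since \<open>f\<close> has a root modulo
  every prime \<open>p\<close>, the recurrence forgets its past modulo \<open>p\<close>, so the sequence is eventually
  \<open>p\<close>-periodic modulo \<open>p\<close>; it is not eventually \<open>0\<close> modulo \<open>p\<close>, because \<open>h\<close> is not. Let \<open>S\<close> consist of
  \<open>3\<close> and the primes dividing some term. If \<open>S\<close> is finite with product \<open>N\<close>, the Chinese remainder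
  theorem yields a residue class modulo \<open>N\<close> on which the late terms are prime to all of \<open>S\<close>, hence
  equal to \<open>1\<close> or \<open>-1\<close>, and periodicity modulo \<open>3\<close> makes them equal to a single \<open>c\<close>. The \<open>N\<close>-step
  recurrence \<open>a (n + N) = F(n) * a n + G(n)\<close> has polynomial coefficients, so \<open>c = F * c + G\<close> holds
  identically and \<open>a (n + N) - c = F(n) * (a n - c)\<close> for every \<open>n\<close>. As \<open>F(n)\<close> is a product of \<open>N\<close>
  consecutive values of \<open>f\<close>, it is divisible by all primes in \<open>S\<close>. Thus all terms from index \<open>N\<close> on are
  prime to \<open>S\<close>, i.e. equal to \<open>1\<close> or \<open>-1\<close>, and the sequence is bounded.
\<close>

lemma poly_cong_int:
  fixes q :: "int poly"
  assumes "[x = y] (mod m)"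
  shows "[poly q x = poly q y] (mod m)"
  by (induction q) (auto intro!: cong_add cong_mult assms)

lemma ex_nat_cong_between:
  fixes x :: int and k p :: nat
  assumes "p > 0"
  shows "\<exists>n. k \<le> n \<and> n < k + p \<and> [int n = x] (mod int p)"
proof -
  define r where "r = (x - int k) mod int p"
  have r: "0 \<le> r" "r < int p"
    using assms by (auto simp: r_def)
  have "[int k + r = int k + (x - int k)] (mod int p)"
    unfolding r_def by (intro cong_add) (auto simp: cong_def)
  then have "[int (k + nat r) = x] (mod int p)"
    using r by simp
  then show ?thesis
    using r by (intro exI[of _ "k + nat r"]) auto
qed

text \<open>Some index \<open>n0\<close> in 1..\<open>p\<close> is a root of \<open>g\<close> modulo
  \<open>p\<close>. There the previous term drops out, so \<open>b n0\<close> and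
  \<open>b (n0 + d)\<close> both reduce to values of \<open>h\<close>; the recurrence then carries
  the congruence upwards.\<close>

lemma linear_recurrence_cong:
  fixes g h :: "int poly" and b :: "nat \<Rightarrow> int" and p d n :: nat
  assumes rec: "\<And>n. b (Suc n) = poly g (int (Suc n)) * b n + poly h (int (Suc n))"
    and "p > 0" "int p dvd poly g x" "p dvd d" "p \<le> n"
  shows "[b (n + d) = b n] (mod int p)"
proof -
  obtain n0 where n0: "1 \<le> n0" "n0 < 1 + p" "[int n0 = x] (mod int p)"
    using ex_nat_cong_between[OF \<open>p > 0\<close>] by blast
  have shift: "[int (k + d) = int k] (mod int p)" for k
    using \<open>p dvd d\<close> by (metis cong_add_lcancel_0 cong_0_iff int_dvd_int_iff of_nat_add)
  have "[poly g (int n0) = 0] (mod int p)"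
    using poly_cong_int[OF n0(3), of g] assms(3) by (metis cong_0_iff cong_dvd_iff)
  moreover have "[poly g (int (n0 + d)) = poly g (int n0)] (mod int p)"
    by (intro poly_cong_int shift)
  ultimately have g0: "int p dvd poly g (int n0)" "int p dvd poly g (int (n0 + d))"
    by (auto simp: cong_0_iff dest: cong_dvd_iff)
  obtain m where m: "n0 = Suc m"
    using n0(1) by (cases n0) auto
  have "n0 \<le> n" using n0 assms by simp
  then show ?thesis
  proof (induction n rule: dec_induct)
    case base
    have "[b (n0 + d) = poly h (int (n0 + d))] (mod int p)"
      using rec[of "m + d"] g0(2) by (simp add: m cong_iff_dvd_diff)
    also have "[poly h (int (n0 + d)) = poly h (int n0)] (mod int p)"
      by (intro poly_cong_int shift)
    also have "[poly h (int n0) = b n0] (mod int p)"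
      using rec[of m] g0(1) by (simp add: m cong_iff_dvd_diff)
    finally show ?case .
  next
    case (step k)
    have "[poly g (int (Suc k + d)) * b (k + d) + poly h (int (Suc k + d))
         = poly g (int (Suc k)) * b k + poly h (int (Suc k))] (mod int p)"
      by (intro cong_add cong_mult poly_cong_int shift step.IH)
    then show ?case
      using rec[of "k + d"] rec[of k] by simp
  qed
qed

text \<open>For fixed \<open>k\<close> the coefficients are polynomials in \<open>n\<close>, so a
  relation found at infinitely many indices holds at all of them. The product form of
  \<open>F\<close> serves to read off prime divisors.\<close>

lemma linear_recurrence_multi_step:
  fixes g h :: "int poly" and b :: "nat \<Rightarrow> int"
  assumes rec: "\<And>n. b (Suc n) = poly g (int (Suc n)) * b n + poly h (int (Suc n))"
  shows "\<exists>F G. (\<forall>x. poly F x = (\<Prod>i<k. poly g (x + int (Suc i)))) \<and>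
               (\<forall>n. b (n + k) = poly F (int n) * b n + poly G (int n))"
proof (induction k)
  case 0
  show ?case by (intro exI[of _ 1] exI[of _ 0]) auto
next
  case (Suc k)
  then obtain F G where FG: "\<And>x. poly F x = (\<Prod>i<k. poly g (x + int (Suc i)))"
    "\<And>n. b (n + k) = poly F (int n) * b n + poly G (int n)"
    by blast
  define s where "s = [:int (Suc k), 1:]"
  show ?case
  proof (rule exI[of _ "pcompose g s * F"], rule exI[of _ "pcompose g s * G + pcompose h s"],
      intro conjI allI)
    fix x :: int
    show "poly (pcompose g s * F) x = (\<Prod>i<Suc k. poly g (x + int (Suc i)))"
      by (simp add: s_def poly_pcompose FG(1) add_ac mult.commute)
  next
    fix n
    show "b (n + Suc k) = poly (pcompose g s * F) (int n) * b n
            + poly (pcompose g s * G + pcompose h s) (int n)"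
      using rec[of "n + k"] FG(2)[of n] by (simp add: s_def poly_pcompose algebra_simps)
  qed
qed

lemma abs_eq_1_if_no_prime_dvd:
  fixes z :: int
  assumes "\<And>p. prime p \<Longrightarrow> \<not> int p dvd z"
  shows "\<bar>z\<bar> = 1"
proof (rule ccontr)
  assume "\<bar>z\<bar> \<noteq> 1"
  then have "nat \<bar>z\<bar> \<noteq> 1" by auto
  then obtain p where "prime p" "p dvd nat \<bar>z\<bar>"
    using prime_factor_nat by blast
  then show False
    using assms[of p] by (simp add: int_dvd_int_iff[symmetric])
qed

lemma linear_recurrence_finite_range:
  fixes g h :: "int poly" and b :: "nat \<Rightarrow> int"
  assumes rec: "\<And>n. b (Suc n) = poly g (int (Suc n)) * b n + poly h (int (Suc n))"
    and loc: "\<And>p :: nat. prime p \<Longrightarrow> \<exists>n m. int p dvd poly g n \<and> \<not> int p dvd poly h m"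
    and fin: "finite (seq_primes b)"
  shows "finite (range b)"
proof -
  \<comment> \<open>The prime 3 is added because it separates 1 from -1.\<close>
  define S where "S = insert 3 (seq_primes b)"
  define N where "N = \<Prod>S"
  have finS: "finite S" using fin by (simp add: S_def)
  have prime_S: "prime p" if "p \<in> S" for p
    using that by (auto simp: S_def seq_primes_def)
  then have Npos: "N > 0"
    unfolding N_def using prime_gt_0_nat by (intro prod_pos) blast
  have dvdN: "p dvd N" if "p \<in> S" for p
    unfolding N_def using finS that by (rule dvd_prodI)
  have leN: "p \<le> N" if "p \<in> S" for p
    using dvdN[OF that] Npos by (rule dvd_imp_le)
  have unit: "\<bar>b n\<bar> = 1" if "\<And>p. p \<in> S \<Longrightarrow> \<not> int p dvd b n" for n
    using that by (intro abs_eq_1_if_no_prime_dvd) (auto simp: S_def seq_primes_def)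
  have per: "[b m = b n] (mod int p)" if p: "p \<in> S" and "N \<le> n" "n \<le> m" "[m = n] (mod p)" for p m n
  proof -
    obtain x where "int p dvd poly g x"
      using loc[OF prime_S[OF p]] by blast
    moreover have "p dvd m - n"
      using that by (simp add: cong_altdef_nat)
    ultimately show ?thesis
      using linear_recurrence_cong[OF rec, of p x "m - n" n] prime_gt_0_nat[OF prime_S[OF p]]
        leN[OF p] that by auto
  qed
  \<comment> \<open>Otherwise the recurrence makes \<open>p\<close> divide \<open>h\<close> at every
    index above \<open>N\<close>, and these indices meet every residue class modulo
    \<open>p\<close>.\<close>
  have "\<exists>n\<ge>N. \<not> int p dvd b n" if "p \<in> S" for p
  proof (rule ccontr)
    assume "\<not> (\<exists>n\<ge>N. \<not> int p dvd b n)"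
    then have all: "int p dvd b n" if "n \<ge> N" for n
      using that by blast
    obtain m where m: "\<not> int p dvd poly h m"
      using loc[OF prime_S[OF \<open>p \<in> S\<close>]] by blast
    obtain n where n: "Suc N \<le> n" "[int n = m] (mod int p)"
      using ex_nat_cong_between[OF prime_gt_0_nat[OF prime_S[OF \<open>p \<in> S\<close>]]] by blast
    obtain k where k: "n = Suc k" "N \<le> k"
      using n(1) by (cases n) auto
    have "int p dvd poly h (int n)"
      using rec[of k] all[of k] all[of n] k n
      by (metis dvd_add_right_iff dvd_mult le_SucI)
    then show False
      using m poly_cong_int[OF n(2), of h] cong_dvd_iff by blast
  qed
  then obtain u where u: "\<And>p. p \<in> S \<Longrightarrow> N \<le> u p \<and> \<not> int p dvd b (u p)"
    by metis
  have "\<exists>x. \<forall>p\<in>S. [x = u p] (mod id p)"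
    using finS prime_S by (intro chinese_remainder_nat) (auto simp: primes_coprime)
  then obtain x where x: "\<And>p. p \<in> S \<Longrightarrow> [x = u p] (mod p)"
    by auto
  \<comment> \<open>Adding a multiple of \<open>N\<close> keeps all residues of \<open>x\<close> and
    lifts \<open>y\<close> above \<open>N\<close> and every \<open>u p\<close>, as
    \<open>per\<close> requires.\<close>
  define y where "y = x + N * (N + sum u S)"
  have y_ge: "N + sum u S \<le> y"
    unfolding y_def using Npos by (intro trans_le_add2) simp
  have y_cong: "[y + k * N = u p] (mod p)" if "p \<in> S" for p k
  proof -
    have "[x + (N * (N + sum u S) + k * N) = u p + 0] (mod p)"
      using x[OF that] dvdN[OF that] by (intro cong_add) (simp_all add: cong_0_iff)
    then show ?thesis by (simp add: y_def add.assoc)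
  qed
  have "\<not> int p dvd b (y + k * N)" if "p \<in> S" for p k
  proof -
    have "u p \<le> sum u S"
      using finS that by (simp add: member_le_sum)
    then have "[b (y + k * N) = b (u p)] (mod int p)"
      using u[OF that] y_ge y_cong[OF that] by (intro per that) auto
    then show ?thesis
      using u[OF that] cong_dvd_iff by blast
  qed
  then have unit_y: "\<bar>b (y + k * N)\<bar> = 1" for k
    by (intro unit)
  define c where "c = b y"
  have c: "\<bar>c\<bar> = 1"
    using unit_y[of 0] by (simp add: c_def)
  have const: "b (y + k * N) = c" for k
  proof -
    have "3 \<in> S" by (simp add: S_def)
    then have "[b (y + k * N) = c] (mod 3)"
      using per[of 3 y "y + k * N"] y_ge dvdN[of 3] by (simp add: c_def cong_altdef_nat)
    then have "3 dvd b (y + k * N) - c"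
      by (simp add: cong_iff_dvd_diff)
    then show ?thesis
      using unit_y[of k] c by presburger
  qed
  obtain F G where F: "\<And>x. poly F x = (\<Prod>i<N. poly g (x + int (Suc i)))"
    and FG: "\<And>n. b (n + N) = poly F (int n) * b n + poly G (int n)"
    using linear_recurrence_multi_step[OF rec] by metis
  \<comment> \<open>\<open>Q\<close> measures how far \<open>c\<close> is from being fixed by the
    \<open>N\<close>-step recurrence. It vanishes at every \<open>y + k * N\<close>, hence
    identically.\<close>
  define Q where "Q = smult c F + G - [:c:]"
  have "Q = 0"
  proof (rule ccontr)
    assume "Q \<noteq> 0"
    have "poly Q (int (y + k * N)) = 0" for k
      using FG[of "y + k * N"] const[of k] const[of "Suc k"]
      by (simp add: Q_def algebra_simps)
    then have "range (\<lambda>k. int (y + k * N)) \<subseteq> {z. poly Q z = 0}"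
      by blast
    then have "finite (range (\<lambda>k. int (y + k * N)))"
      using poly_roots_finite[OF \<open>Q \<noteq> 0\<close>] finite_subset by blast
    moreover have "inj (\<lambda>k. int (y + k * N))"
      using Npos by (auto simp: inj_on_def)
    ultimately show False
      using finite_imageD by blast
  qed
  have step: "b (n + N) - c = poly F (int n) * (b n - c)" for n
  proof -
    have "poly Q (int n) = 0" using \<open>Q = 0\<close> by simp
    then show ?thesis
      using FG[of n] by (simp add: Q_def algebra_simps)
  qed
  have "\<bar>b (n + N)\<bar> = 1" for n
  proof (rule unit)
    fix p assume p: "p \<in> S"
    obtain z where z: "int p dvd poly g z"
      using loc[OF prime_S[OF p]] by blast
    obtain m where m: "Suc n \<le> m" "m < Suc n + p" "[int m = z] (mod int p)"
      using ex_nat_cong_between[OF prime_gt_0_nat[OF prime_S[OF p]]] by blast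
    \<comment> \<open>As \<open>p \<le> N\<close>, the arguments \<open>n + 1\<close>, ...,
      \<open>n + N\<close> meet the class of the root \<open>z\<close>; \<open>i\<close> is the
      position of the corresponding factor of \<open>F\<close>.\<close>
    define i where "i = m - Suc n"
    have i: "i < N" "int n + int (Suc i) = int m"
      using m leN[OF p] by (auto simp: i_def)
    have "int p dvd poly g (int n + int (Suc i))"
      unfolding i(2) using z poly_cong_int[OF m(3), of g] cong_dvd_iff by blast
    then have "int p dvd poly F (int n)"
      unfolding F using i(1) by (meson dvd_prodI dvd_trans finite_lessThan lessThan_iff)
    then have "int p dvd b (n + N) - c"
      unfolding step by simp
    moreover have "\<not> int p dvd c"
      using c prime_gt_1_nat[OF prime_S[OF p]] by (auto simp: abs_if split: if_splits)
    ultimately show "\<not> int p dvd b (n + N)"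
      using cong_iff_dvd_diff cong_dvd_iff by blast
  qed
  then have unit_N: "\<bar>b n\<bar> = 1" if "N \<le> n" for n
    using that by (metis le_add_diff_inverse2)
  have "b n = 1 \<or> b n = -1" if "N \<le> n" for n
    using unit_N[OF that] by linarith
  then have "b n \<in> b ` {..<N} \<union> {1, -1}" for n
    by (cases "n < N") (auto simp: not_less)
  then have "range b \<subseteq> b ` {..<N} \<union> {1, -1}"
    by blast
  then show ?thesis
    by (rule finite_subset) simp
qed

theorem theorem12:
  fixes f h\<^sub>1 :: "int poly" and \<epsilon> :: int and a :: "nat \<Rightarrow> int"
  assumes "\<epsilon> \<in> {1, -1}"
    and "a 0 = poly h\<^sub>1 0"
    and "\<And>n. n > 0 \<Longrightarrow> a n = poly f (int n) * a (n - 1) + \<epsilon> ^ n * poly h\<^sub>1 (int n)"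
    and "\<not> bounded (range (\<lambda>n. real_of_int (a n)))"
    and "\<And>p :: nat. prime p \<Longrightarrow>
           \<exists>(n :: int) (m :: int). int p dvd poly f n \<and> \<not> int p dvd poly h\<^sub>1 m"
  shows "infinite (seq_primes a)"
proof
  assume fin: "finite (seq_primes a)"
  define b where "b n = \<epsilon> ^ n * a n" for n
  have sq: "\<epsilon> ^ n * \<epsilon> ^ n = 1" for n
    using assms(1) by (auto simp flip: power_mult_distrib)
  have a_b: "a n = \<epsilon> ^ n * b n" for n
    using sq[of n] by (simp add: b_def flip: mult.assoc)
  have "b (Suc n) = poly (smult \<epsilon> f) (int (Suc n)) * b n + poly h\<^sub>1 (int (Suc n))" for n
  proof -
    have "b (Suc n) = \<epsilon> ^ Suc n * (poly f (int (Suc n)) * a n)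
        + (\<epsilon> ^ Suc n * \<epsilon> ^ Suc n) * poly h\<^sub>1 (int (Suc n))"
      unfolding b_def using assms(3)[of "Suc n"] by (simp add: algebra_simps)
    then show ?thesis
      unfolding sq by (simp add: b_def algebra_simps)
  qed
  moreover have "\<exists>n m. int p dvd poly (smult \<epsilon> f) n \<and> \<not> int p dvd poly h\<^sub>1 m" if "prime p" for p
    using assms(5)[OF that] by (metis dvd_mult poly_smult)
  moreover have "finite (seq_primes b)"
  proof (rule finite_subset[OF _ fin])
    show "seq_primes b \<subseteq> seq_primes a"
      unfolding seq_primes_def a_b by (blast intro: dvd_mult)
  qed
  ultimately have "finite (range b)"
    by (rule linear_recurrence_finite_range)
  \<comment> \<open>Each \<open>a n\<close> is \<open>b n\<close> up to sign, so finitely many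
    values of \<open>b\<close> leave finitely many for \<open>a\<close>.\<close>
  then have fin_b: "finite (range b \<union> uminus ` range b)"
    by simp
  have "a n \<in> range b \<union> uminus ` range b" for n
  proof -
    have "\<epsilon> ^ n = 1 \<or> \<epsilon> ^ n = -1"
      using assms(1) by (cases "even n") auto
    then show ?thesis
      using a_b[of n] by auto
  qed
  then have "range a \<subseteq> range b \<union> uminus ` range b"
    by blast
  then have "finite (range a)"
    using fin_b by (rule finite_subset)
  then have "finite (real_of_int ` range a)"
    by simp
  then have "bounded (range (\<lambda>n. real_of_int (a n)))"
    by (simp add: image_image finite_imp_bounded)
  then show False
    using assms(4) by contradiction
qed

end
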